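(* Let $\mathcal{E}$ be a collection of analytic equivalence relations on standard Borel spaces such that every $E\in\mathcal{E}$ is idealistic, and $\mathcal{E}$ contains all countable Borel equivalence relations. Then $\mathcal{E}$ is not downward closed under Borel reducibility.
   Context: For equivalence relations $E$ on $X$ and $F$ on $Y$ ($X,Y$ standard Borel), $E\leq_B F$ ($E$ is Borel reducible to $F$) means there is a Borel $f\colon X\to Y$ with $x\mathrel{E}x'\iff f(x)\mathrel{F}f(x')$ for all $x,x'\in X$. A collection $\mathcal{E}$ of analytic equivalence relations is downward closed under Borel reducibility if whenever $F\in\mathcal{E}$ and $E$ is an analytic equivalence relation with $E\leq_B F$, then $E\in\mathcal{E}$. A Borel equivalence relation is countable if all of its classes are countable. An analytic equivalence relation $E$ on a standard Borel space $X$ is idealistic if there is a map assigning to each class $C\in X/E$ a $\sigma$-ideal $I_C$ of subsets of $C$ with $C\notin I_C$ which is ccc (every family of pairwise disjoint relatively Borel subsets of $C$ none of which is in $I_C$ is countable) and such that $C\mapsto I_C$ is Borel, in the sense that for each Borel $A\subseteq X^2$ the set $\{x\in X: \{y\in[x]_E:(x,y)\in A\}\in I_{[x]_E}\}$ is Borel. *)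

theory Defs
  imports "HOL-Analysis.Analysis" "HOL-Library.Equipollence"
begin

text \<open>
  Measurable spaces are represented, as usual in HOL-Analysis, by the type \<open>'a measure\<close>.
  Only \<open>space M\<close> and \<open>sets M\<close> matter below; the measure component \<open>emeasure M\<close> is
  never used. An equivalence relation on a space is the pair of the space and the relation.
\<close>

definition standard_borel :: "'a measure \<Rightarrow> bool" where
  "standard_borel M \<longleftrightarrow>
     (\<exists>T. completely_metrizable_space T \<and> second_countable T \<and> topspace T = space M \<and>
          sets M = sigma_sets (topspace T) {U. openin T U})"

text \<open>
  A subset of a standard Borel space is analytic if it is empty or the Borel image of the Baire
  space; \<open>borel\<close> on \<^typ>\<open>nat \<Rightarrow> nat\<close> is the Borel algebra of the product topology.
\<close>

definition analytic_set :: "'a measure \<Rightarrow> 'a set \<Rightarrow> bool" where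
  "analytic_set M A \<longleftrightarrow>
     A = {} \<or> (\<exists>f \<in> (borel :: (nat \<Rightarrow> nat) measure) \<rightarrow>\<^sub>M M. A = range f)"

definition analytic_equiv_rel :: "'a measure \<Rightarrow> ('a \<times> 'a) set \<Rightarrow> bool" where
  "analytic_equiv_rel M E \<longleftrightarrow>
     standard_borel M \<and> equiv (space M) E \<and> analytic_set (M \<Otimes>\<^sub>M M) E"

definition countable_borel_equiv_rel :: "'a measure \<Rightarrow> ('a \<times> 'a) set \<Rightarrow> bool" where
  "countable_borel_equiv_rel M E \<longleftrightarrow>
     standard_borel M \<and> equiv (space M) E \<and> E \<in> sets (M \<Otimes>\<^sub>M M) \<and>
     (\<forall>C \<in> space M // E. countable C)"

definition borel_reducible ::
  "'a measure \<Rightarrow> ('a \<times> 'a) set \<Rightarrow> 'b measure \<Rightarrow> ('b \<times> 'b) set \<Rightarrow> bool" where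
  "borel_reducible M E N F \<longleftrightarrow>
     (\<exists>f \<in> M \<rightarrow>\<^sub>M N. \<forall>x \<in> space M. \<forall>x' \<in> space M. (x, x') \<in> E \<longleftrightarrow> (f x, f x') \<in> F)"

definition sigma_ideal_on :: "'a set \<Rightarrow> 'a set set \<Rightarrow> bool" where
  "sigma_ideal_on C I \<longleftrightarrow>
     I \<subseteq> Pow C \<and> {} \<in> I \<and>
     (\<forall>A \<in> I. \<forall>B. B \<subseteq> A \<longrightarrow> B \<in> I) \<and>
     (\<forall>A :: nat \<Rightarrow> 'a set. range A \<subseteq> I \<longrightarrow> (\<Union>n. A n) \<in> I)"

text \<open>
  For \<open>C \<subseteq> space M\<close>, the relatively Borel subsets of \<open>C\<close> are \<open>sets (restrict_space M C)\<close>;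
  \<open>C\<close> itself need not be Borel.
\<close>

definition ccc_ideal :: "'a measure \<Rightarrow> 'a set \<Rightarrow> 'a set set \<Rightarrow> bool" where
  "ccc_ideal M C I \<longleftrightarrow>
     (\<forall>\<D>. \<D> \<subseteq> sets (restrict_space M C) \<and> disjoint \<D> \<and> \<D> \<inter> I = {} \<longrightarrow> countable \<D>)"

definition idealistic :: "'a measure \<Rightarrow> ('a \<times> 'a) set \<Rightarrow> bool" where
  "idealistic M E \<longleftrightarrow>
     analytic_equiv_rel M E \<and>
     (\<exists>I :: 'a set \<Rightarrow> 'a set set.
        (\<forall>C \<in> space M // E. sigma_ideal_on C (I C) \<and> C \<notin> I C \<and> ccc_ideal M C (I C)) \<and>
        (\<forall>A \<in> sets (M \<Otimes>\<^sub>M M).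
           {x \<in> space M. {y \<in> E `` {x}. (x, y) \<in> A} \<in> I (E `` {x})} \<in> sets M))"

text \<open>
  The standard Borel spaces form a proper class, so a collection of equivalence relations is taken
  over the standard Borel spaces whose points lie in an arbitrary type \<open>'a\<close>. If the reals inject
  into \<open>'a\<close>, an isomorphic copy of every standard Borel space occurs there; failure of downward
  closure inside \<open>'a\<close> is then failure for any collection over larger universes that restricts to it.
\<close>

definition downward_closed :: "('a measure \<times> ('a \<times> 'a) set) set \<Rightarrow> bool" where
  "downward_closed \<E> \<longleftrightarrow>
     (\<forall>N F M E. (N, F) \<in> \<E> \<longrightarrow> analytic_equiv_rel M E \<longrightarrow> borel_reducible M E N F
        \<longrightarrow> (M, E) \<in> \<E>)"

end

theory Submission
  imports Defs
begin

text \<open>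
  An idealistic relation permits Borel decisions about its classes. If a Borel set splits each class
  \<open>C\<close> into two pieces, then "the first piece is in \<open>I C\<close>" is a Borel invariant condition; when it
  holds, the second piece is nonempty as \<open>C \<notin> I C\<close>, and when it fails, the first piece is nonempty as
  \<open>{} \<in> I C\<close>. So it suffices to exhibit a relation that Borel reduces to the identity, which is a
  countable Borel equivalence relation, but whose classes split into two pieces in such a way that
  no Borel invariant set picks a nonempty piece of every class (\<open>no_borel_choice_of_direction\<close>).

  Read a point \<open>y\<close> of the Baire space as a pair of codes \<open>c, c'\<close> of analytic sets. Membership of
  \<open>y\<close> in the two coded sets means that two trees, \<open>left_tree y\<close> and \<open>right_tree y\<close>, have infinite
  branches. The relation lives on triples of a point \<open>y\<close>, a direction and a simulation between these
  trees in that direction, and two triples are equivalent when they have the same \<open>y\<close>. Any two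
  trees are comparable by a simulation (\<open>simulation_total\<close>), so every \<open>y\<close> occurs.

  Suppose that a Borel invariant set chose a possible direction for every \<open>y\<close>. Let \<open>Q\<close> be the set
  of \<open>y\<close> for which it chooses left to right and \<open>Q'\<close> the complement. Both are projections of Borel
  sets, because every \<open>y\<close> occurs, so both are coded, say by \<open>c\<close> and \<open>c'\<close>
  (\<open>borel_imp_proj_closed\<close>, \<open>proj_closed_imp_tree\<close>). Take the point \<open>y\<close> that codes this pair.
  If \<open>y \<in> Q\<close>, then the left tree has an infinite branch and the right one has none; but a simulation
  from left to right carries branches to branches. The case \<open>y \<in> Q'\<close> is symmetric.
\<close>

section \<open>Projections of closed sets in the Baire space\<close>

type_synonym baire = "nat \<Rightarrow> nat"

text \<open>
  A point of the Baire space also stands for a sequence of points, its columns. This gives pairs,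
  triples and sequences without leaving the space.
\<close>

definition col :: "nat \<Rightarrow> baire \<Rightarrow> baire" where
  "col j x = (\<lambda>n. x (prod_encode (j, n)))"

definition join :: "(nat \<Rightarrow> baire) \<Rightarrow> baire" where
  "join u = (\<lambda>m. case prod_decode m of (j, n) \<Rightarrow> u j n)"

lemma col_join [simp]: "col j (join u) = u j"
  by (simp add: col_def join_def)

lemma continuous_on_col:
  "continuous_on A f \<Longrightarrow> continuous_on A (\<lambda>x. col j (f x))"
  unfolding col_def
  by (rule continuous_on_coordinatewise_then_product)
    (rule continuous_on_product_then_coordinatewise[where f = f])

lemmas continuous_col_intros =
  continuous_on_col continuous_on_fst continuous_on_snd continuous_on_Pair continuous_on_id

text \<open>
  These are the analytic sets. The form with a closed set, rather than a Borel image, is what the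
  coding by trees needs.
\<close>

definition proj_closed :: "baire set \<Rightarrow> bool" where
  "proj_closed A \<longleftrightarrow> (\<exists>K :: (baire \<times> baire) set. closed K \<and> A = {x. \<exists>z. (x, z) \<in> K})"

lemma closed_imp_proj_closed:
  assumes "closed A"
  shows "proj_closed A"
  unfolding proj_closed_def
  by (rule exI[of _ "A \<times> UNIV"]) (use assms in \<open>auto intro: closed_Times\<close>)

lemma closed_preimage:
  fixes f :: "'a::topological_space \<Rightarrow> 'b::topological_space"
  assumes "closed K" "continuous_on UNIV f"
  shows "closed {x. f x \<in> K}"
  using closed_vimage[OF assms] by (simp add: vimage_def)

text \<open>The columns of a single witness serve as witnesses for all the sets at once.\<close>

lemma proj_closed_INT:
  assumes "\<And>n :: nat. proj_closed (A n)"
  shows "proj_closed (\<Inter>n. A n)"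
proof -
  obtain K :: "nat \<Rightarrow> (baire \<times> baire) set"
    where K: "\<And>n. closed (K n)" "\<And>n. A n = {x. \<exists>z. (x, z) \<in> K n}"
    using assms unfolding proj_closed_def by metis
  define L where "L = (\<Inter>n. {p. (fst p, col n (snd p)) \<in> K n})"
  have "closed L"
    unfolding L_def by (intro closed_INT ballI closed_preimage K continuous_col_intros)
  moreover have "(\<Inter>n. A n) = {x. \<exists>z. (x, z) \<in> L}"
  proof (intro equalityI subsetI)
    fix x assume "x \<in> (\<Inter>n. A n)"
    then obtain u where "\<And>n. (x, u n) \<in> K n"
      using K(2) by simp metis
    then have "(x, join u) \<in> L"
      by (simp add: L_def)
    then show "x \<in> {x. \<exists>z. (x, z) \<in> L}" by blast
  qed (auto simp: L_def K(2))
  ultimately show ?thesis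
    unfolding proj_closed_def by blast
qed

text \<open>
  The witness names an index in column 0 and supplies in column 1 a witness for the set of that
  index. Stating this as an intersection over all \<open>n\<close>, with "the index is not \<open>n\<close>" as an
  alternative, keeps the set closed.
\<close>

lemma proj_closed_UN:
  assumes "\<And>n :: nat. proj_closed (A n)"
  shows "proj_closed (\<Union>n. A n)"
proof -
  obtain K :: "nat \<Rightarrow> (baire \<times> baire) set"
    where K: "\<And>n. closed (K n)" "\<And>n. A n = {x. \<exists>z. (x, z) \<in> K n}"
    using assms unfolding proj_closed_def by metis
  define L where "L = (\<Inter>n. {p. col 0 (snd p) 0 \<in> - {n}} \<union> {p. (fst p, col 1 (snd p)) \<in> K n})"
  have "continuous_on UNIV (\<lambda>p :: baire \<times> baire. col 0 (snd p) 0)"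
    by (rule continuous_on_product_then_coordinatewise[where f = "\<lambda>p. col 0 (snd p)"];
        intro continuous_col_intros)
  then have tag: "closed {p :: baire \<times> baire. col 0 (snd p) 0 \<in> - {n}}" for n
    by (rule closed_preimage[rotated]) (simp add: closed_def open_discrete)
  have K': "closed {p. (fst p, col 1 (snd p)) \<in> K n}" for n
    by (rule closed_preimage[OF K(1)]; intro continuous_col_intros)
  have "closed L"
    unfolding L_def by (intro closed_INT ballI closed_Un tag K')
  moreover have "(\<Union>n. A n) = {x. \<exists>z. (x, z) \<in> L}"
  proof (intro equalityI subsetI)
    fix x assume "x \<in> (\<Union>n. A n)"
    then obtain n z where "(x, z) \<in> K n"
      using K(2) by auto
    then have "(x, join (\<lambda>j. if j = 0 then (\<lambda>_. n) else z)) \<in> L"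
      by (simp add: L_def)
    then show "x \<in> {x. \<exists>z. (x, z) \<in> L}" by blast
  next
    fix x assume "x \<in> {x. \<exists>z. (x, z) \<in> L}"
    then obtain z where "(x, col 1 z) \<in> K (col 0 z 0)"
      unfolding L_def by fastforce
    then show "x \<in> (\<Union>n. A n)"
      unfolding K(2) by blast
  qed
  ultimately show ?thesis
    unfolding proj_closed_def by blast
qed

text \<open>The new witness consists of a preimage and the old witness for that preimage.\<close>

lemma proj_closed_col_image:
  assumes "proj_closed B"
  shows "proj_closed (col j ` B)"
proof -
  obtain K :: "(baire \<times> baire) set" where K: "closed K" "B = {x. \<exists>z. (x, z) \<in> K}"
    using assms unfolding proj_closed_def by metis
  define L where
    "L = {p. col j (col 0 (snd p)) = fst p} \<inter> {p. (col 0 (snd p), col 1 (snd p)) \<in> K}"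
  have "closed L"
    unfolding L_def
  proof (rule closed_Int)
    have "closed {p :: baire \<times> baire. col j (col 0 (snd p)) i = fst p i}" for i
    proof (rule closed_Collect_eq)
      show "continuous_on UNIV (\<lambda>p :: baire \<times> baire. col j (col 0 (snd p)) i)"
        by (rule continuous_on_product_then_coordinatewise
            [where f = "\<lambda>p. col j (col 0 (snd p))"]; intro continuous_col_intros)
      show "continuous_on UNIV (\<lambda>p :: baire \<times> baire. fst p i)"
        by (rule continuous_on_product_then_coordinatewise[where f = fst])
          (intro continuous_col_intros)
    qed
    then show "closed {p :: baire \<times> baire. col j (col 0 (snd p)) = fst p}"
      unfolding fun_eq_iff by (rule closed_Collect_all)
    show "closed {p. (col 0 (snd p), col 1 (snd p)) \<in> K}"
      by (rule closed_preimage[OF K(1)]; intro continuous_col_intros)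
  qed
  moreover have "col j ` B = {y. \<exists>w. (y, w) \<in> L}"
  proof (intro equalityI subsetI)
    fix y assume "y \<in> col j ` B"
    then obtain x z where "(x, z) \<in> K" "y = col j x"
      using K(2) by auto
    then have "(y, join (\<lambda>i. if i = 0 then x else z)) \<in> L"
      by (simp add: L_def)
    then show "y \<in> {y. \<exists>w. (y, w) \<in> L}" by blast
  qed (auto simp: L_def K(2))
  ultimately show ?thesis
    unfolding proj_closed_def by blast
qed

text \<open>
  The sets for which both the set and its complement are projections of closed sets form a
  \<open>\<sigma>\<close>-algebra. It contains the generators of the product \<open>\<sigma>\<close>-algebra, since a condition on a single
  coordinate defines a clopen set.
\<close>

lemma borel_imp_proj_closed:
  assumes "A \<in> sets (borel :: baire measure)"
  shows "proj_closed A"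
proof -
  let ?G = "{{f. f i \<in> B} | i B. True} :: baire set set"
  have "sets (borel :: baire measure) = sets (Pi\<^sub>M UNIV (\<lambda>_::nat. borel :: nat measure))"
    by (simp add: sets_PiM_equal_borel)
  also have "\<dots> = sigma_sets UNIV ?G"
    by (simp add: sets_PiM_single sets_borel_eq_count_space)
  finally have "A \<in> sigma_sets UNIV ?G"
    using assms by simp
  then have "proj_closed A \<and> proj_closed (- A)"
  proof induction
    case (Basic a)
    then obtain i B where a: "a = {f. f i \<in> B}" by auto
    have "closed {f :: baire. f i \<in> C}" for C
      by (intro closed_preimage continuous_on_product_coordinates)
        (simp add: closed_def open_discrete)
    from this[of B] this[of "- B"] show ?case
      by (auto simp: a Collect_neg_eq[symmetric] intro!: closed_imp_proj_closed)
  next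
    case Empty
    then show ?case by (auto intro: closed_imp_proj_closed)
  next
    case (Compl a)
    then show ?case by (simp add: Compl_eq_Diff_UNIV[symmetric])
  next
    case (Union a)
    then show ?case
      by (auto simp: intro!: proj_closed_UN proj_closed_INT)
  qed
  then show ?thesis ..
qed

section \<open>A universal family of trees\<close>

text \<open>
  A node \<open>s\<close> is paired with the initial segment of \<open>y\<close> of the same length, so one code \<open>c\<close> yields a tree
  at every point \<open>y\<close>. Nodes may have prefixes that are not nodes; a branch is required to have all
  its initial segments among the nodes.
\<close>

definition tree :: "baire \<Rightarrow> baire \<Rightarrow> nat list set" where
  "tree c y = {s. c (to_nat (map y [0..<length s], s)) = 0}"

definition ill_founded :: "nat list set \<Rightarrow> bool" where
  "ill_founded S \<longleftrightarrow> (\<exists>z. \<forall>n. map z [0..<n] \<in> S)"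

lemma LIMSEQ_prefixes:
  fixes u :: "nat \<Rightarrow> baire"
  assumes "\<And>n. map (u n) [0..<n] = map x [0..<n]"
  shows "u \<longlonglongrightarrow> x"
proof -
  have "eventually (\<lambda>n. u n i = x i) sequentially" for i
    using eventually_gt_at_top[of i]
  proof eventually_elim
    case (elim n)
    with assms[of n] show ?case
      by (simp add: map_eq_conv)
  qed
  then have "(\<lambda>n. u n i) \<longlonglongrightarrow> x i" for i
    by (rule tendsto_eventually)
  then show ?thesis
    using limitin_componentwise[of "\<lambda>_. euclidean" UNIV u x sequentially]
    by (simp add: euclidean_product_topology)
qed

text \<open>
  The code lists the initial segments of points of the closed set \<open>K\<close>. A pair all of whose initial
  segments are listed is a limit of points of \<open>K\<close> and hence lies in \<open>K\<close>. So the trees of \<open>tree\<close> are a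
  universal family for projections of closed sets.
\<close>

lemma proj_closed_imp_tree:
  assumes "proj_closed A"
  obtains c where "\<And>y. y \<in> A \<longleftrightarrow> ill_founded (tree c y)"
proof -
  obtain K :: "(baire \<times> baire) set" where K: "closed K" "A = {x. \<exists>z. (x, z) \<in> K}"
    using assms unfolding proj_closed_def by metis
  define P where "P n x z = to_nat (map x [0..<n], map z [0..<n] :: nat list)" for n and x z :: baire
  define c :: baire where "c m = (if \<exists>n x z. (x, z) \<in> K \<and> P n x z = m then 0 else 1)" for m
  have "(y, z) \<in> K" if z: "\<forall>n. c (P n y z) = 0" for y z
  proof -
    have "\<exists>a b. (a, b) \<in> K \<and> map a [0..<n] = map y [0..<n] \<and> map b [0..<n] = map z [0..<n]" for n
    proof -
      obtain n' a b where "(a, b) \<in> K" "P n' a b = P n y z"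
        using z unfolding c_def by (metis zero_neq_one)
      then have eq: "map a [0..<n'] = map y [0..<n]" "map b [0..<n'] = map z [0..<n]"
        by (simp_all add: P_def)
      from arg_cong[OF this(1), of length] have "n' = n" by simp
      with eq \<open>(a, b) \<in> K\<close> show ?thesis by blast
    qed
    then obtain a b where ab: "\<And>n. (a n, b n) \<in> K"
      "\<And>n. map (a n) [0..<n] = map y [0..<n]" "\<And>n. map (b n) [0..<n] = map z [0..<n]"
      by metis
    have "(\<lambda>n. (a n, b n)) \<longlonglongrightarrow> (y, z)"
      by (intro tendsto_Pair LIMSEQ_prefixes ab)
    then show ?thesis
      using K(1) ab(1) closed_sequentially[of K "\<lambda>n. (a n, b n)"] by blast
  qed
  moreover have "c (P n y z) = 0" if "(y, z) \<in> K" for n y z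
    unfolding c_def using that by metis
  ultimately have "(y, z) \<in> K \<longleftrightarrow> (\<forall>n. c (P n y z) = 0)" for y z
    by blast
  then have "y \<in> A \<longleftrightarrow> ill_founded (tree c y)" for y
    by (simp add: K(2) ill_founded_def tree_def P_def)
  then show ?thesis by (rule that)
qed

section \<open>Simulations between trees\<close>

text \<open>
  Simulations take the place of rank comparison: \<open>T\<close> simulates \<open>S\<close> when the rank of \<open>S\<close> is at most that
  of \<open>T\<close>. A relation, instead of a monotone map, is enough because only the Borel complexity of
  "\<open>R\<close> is a simulation" matters. Once \<open>s\<close> leaves \<open>S\<close> nothing is demanded.
\<close>

definition simulation :: "nat list set \<Rightarrow> nat list set \<Rightarrow> (nat list \<Rightarrow> nat list \<Rightarrow> bool) \<Rightarrow> bool" where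
  "simulation S T R \<longleftrightarrow>
     (\<forall>s t. R s t \<longrightarrow> s \<in> S \<longrightarrow> t \<in> T \<and> (\<forall>k. \<exists>j. R (s @ [k]) (t @ [j])))"

text \<open>Follow the branch of \<open>S\<close> and answer each of its steps by a step in \<open>T\<close>.\<close>

lemma ill_founded_simulation:
  assumes R: "simulation S T R" "R [] []" and "ill_founded S"
  shows "ill_founded T"
proof -
  obtain z where z: "\<And>n. map z [0..<n] \<in> S"
    using assms(3) unfolding ill_founded_def by blast
  let ?P = "\<lambda>n t. R (map z [0..<n]) t \<and> length t = n"
  have "\<exists>t. \<forall>n. ?P n (t n) \<and> (\<exists>j. t (Suc n) = t n @ [j])"
  proof (intro dependent_nat_choice)
    show "\<exists>t. ?P 0 t" using R(2) by simp
  next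
    fix t n assume "?P n t"
    moreover from this obtain j where "R (map z [0..<n] @ [z n]) (t @ [j])"
      using R(1) z[of n] unfolding simulation_def by metis
    ultimately show "\<exists>t'. ?P (Suc n) t' \<and> (\<exists>j. t' = t @ [j])"
      by (intro exI[of _ "t @ [j]"]) auto
  qed
  then obtain t where t: "\<And>n. ?P n (t n)" "\<And>n. \<exists>j. t (Suc n) = t n @ [j]"
    by blast
  define w where "w n = last (t (Suc n))" for n
  have "map w [0..<n] = t n" for n
  proof (induction n)
    case 0
    then show ?case using t(1)[of 0] by simp
  next
    case (Suc n)
    then show ?case using t(2)[of n] by (auto simp: w_def)
  qed
  moreover have "t n \<in> T" for n
    using R(1) z[of n] t(1)[of n] unfolding simulation_def by blast
  ultimately show ?thesis
    unfolding ill_founded_def by metis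
qed

text \<open>
  The complement of the greatest simulation from \<open>S\<close> to \<open>T\<close> is, with its arguments exchanged, a
  simulation from \<open>T\<close> to \<open>S\<close>: were the requirement to fail at \<open>(s, t)\<close>, adding that pair would enlarge
  the greatest simulation. One of the two relates the empty lists. This replaces the comparison of
  ordinal ranks.
\<close>

lemma simulation_total:
  obtains R where "simulation S T R" "R [] []" | R where "simulation T S R" "R [] []"
proof -
  define sim where "sim s t \<longleftrightarrow> (\<exists>R. simulation S T R \<and> R s t)" for s t
  have sim: "simulation S T sim"
    unfolding simulation_def
  proof (intro allI impI)
    fix s t assume "sim s t" "s \<in> S"
    then obtain R where R: "simulation S T R" "R s t"
      unfolding sim_def by blast
    then have "t \<in> T" "\<And>k. \<exists>j. R (s @ [k]) (t @ [j])"
      using \<open>s \<in> S\<close> unfolding simulation_def by auto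
    then show "t \<in> T \<and> (\<forall>k. \<exists>j. sim (s @ [k]) (t @ [j]))"
      unfolding sim_def using R(1) by blast
  qed
  have "simulation T S (\<lambda>t s. \<not> sim s t)"
    unfolding simulation_def
  proof (intro allI impI)
    fix t s assume st: "\<not> sim s t" "t \<in> T"
    show "s \<in> S \<and> (\<forall>k. \<exists>j. \<not> sim (s @ [j]) (t @ [k]))"
    proof (rule ccontr)
      assume "\<not> ?thesis"
      then have *: "s \<in> S \<Longrightarrow> \<exists>k. \<forall>j. sim (s @ [j]) (t @ [k])" by blast
      have "simulation S T (\<lambda>s' t'. sim s' t' \<or> s' = s \<and> t' = t)"
        unfolding simulation_def
      proof (intro allI impI)
        fix s' t' assume "sim s' t' \<or> s' = s \<and> t' = t" "s' \<in> S"
        then have "t' \<in> T \<and> (\<forall>k. \<exists>j. sim (s' @ [k]) (t' @ [j]))"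
          using sim st(2) * unfolding simulation_def by metis
        then show "t' \<in> T \<and> (\<forall>k. \<exists>j. sim (s' @ [k]) (t' @ [j]) \<or> s' @ [k] = s \<and> t' @ [j] = t)"
          by blast
      qed
      then show False
        using st(1) unfolding sim_def by blast
    qed
  qed
  then show ?thesis
    using sim that by (cases "sim [] []") simp_all
qed


section \<open>Simulation triples\<close>

text \<open>
  The code of the tree and the point at which it is taken come from the same \<open>y\<close>; this is the
  diagonalisation.
\<close>

definition left_tree :: "baire \<Rightarrow> nat list set" where
  "left_tree y = tree (col 0 y) y"

definition right_tree :: "baire \<Rightarrow> nat list set" where
  "right_tree y = tree (col 1 y) y"

text \<open>A point \<open>x\<close> is read as a triple of a base point, a relation on nodes and a direction.\<close>

definition base :: "baire \<Rightarrow> baire" where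
  "base x = col 0 x"

definition rel :: "baire \<Rightarrow> nat list \<Rightarrow> nat list \<Rightarrow> bool" where
  "rel x s t \<longleftrightarrow> col 1 x (to_nat (s, t)) = 0"

definition left_to_right :: "baire \<Rightarrow> bool" where
  "left_to_right x \<longleftrightarrow> col 2 x 0 = 0"

definition valid :: "baire \<Rightarrow> bool" where
  "valid x \<longleftrightarrow> rel x [] [] \<and>
     (if left_to_right x then simulation (left_tree (base x)) (right_tree (base x)) (rel x)
      else simulation (right_tree (base x)) (left_tree (base x)) (rel x))"

lemma valid_exists: "\<exists>x. valid x \<and> base x = y"
proof -
  have *: "\<exists>x. base x = y \<and> left_to_right x = d \<and> rel x = R" for d R
    by (rule exI[of _ "join (\<lambda>j. if j = 0 then y
          else if j = 1 then (\<lambda>m. if case_prod R (from_nat m) then 0 else 1)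
          else (\<lambda>_. if d then 0 else 1))"])
      (simp add: base_def left_to_right_def rel_def fun_eq_iff)
  show ?thesis
  proof (cases rule: simulation_total[of "left_tree y" "right_tree y"])
    case (1 R)
    with *[of True R] show ?thesis by (auto simp: valid_def)
  next
    case (2 R)
    with *[of False R] show ?thesis by (auto simp: valid_def)
  qed
qed

lemma valid_ill_founded:
  assumes "valid x"
  shows "left_to_right x \<Longrightarrow> ill_founded (left_tree (base x)) \<Longrightarrow> ill_founded (right_tree (base x))"
    and "\<not> left_to_right x \<Longrightarrow> ill_founded (right_tree (base x)) \<Longrightarrow> ill_founded (left_tree (base x))"
  using assms ill_founded_simulation by (auto simp: valid_def)

lemma measurable_coordinate [measurable]:
  "(\<lambda>x :: baire. x m) \<in> borel \<rightarrow>\<^sub>M count_space UNIV"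
proof -
  have "(\<lambda>x :: baire. x m) \<in> borel_measurable borel"
    by (intro borel_measurable_continuous_onI continuous_on_product_coordinates)
  then show ?thesis
    by (simp add: measurable_cong_sets[OF refl sets_borel_eq_count_space])
qed

text \<open>
  The initial segment of the point determines which coordinate of the code is consulted.
  Quantifying over the countably many possible segments removes this dependence.
\<close>

lemma pred_mem_tree [measurable]:
  "Measurable.pred borel (\<lambda>x. s \<in> tree (col i (base x)) (base x))"
proof -
  have "s \<in> tree (col i (base x)) (base x) \<longleftrightarrow>
      (\<exists>r. length r = length s \<and> (\<forall>k<length s. base x k = r ! k) \<and>
        col i (base x) (to_nat (r, s)) = 0)" (is "_ = (\<exists>r. ?Q r)") for x
  proof
    assume "s \<in> tree (col i (base x)) (base x)"
    then have "?Q (map (base x) [0..<length s])"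
      by (simp add: tree_def)
    then show "\<exists>r. ?Q r" ..
  next
    assume "\<exists>r. ?Q r"
    then obtain r where "?Q r" ..
    moreover from this have "r = map (base x) [0..<length s]"
      by (intro nth_equalityI) auto
    ultimately show "s \<in> tree (col i (base x)) (base x)"
      by (simp add: tree_def)
  qed
  then show ?thesis
    unfolding base_def col_def by (simp only:) measurable
qed

lemma pred_rel [measurable]: "Measurable.pred borel (\<lambda>x. rel x s t)"
  unfolding rel_def col_def by measurable

lemma pred_left_to_right [measurable]: "Measurable.pred borel left_to_right"
  unfolding left_to_right_def col_def by measurable

lemma pred_valid [measurable]: "Measurable.pred borel valid"
  unfolding valid_def simulation_def left_tree_def right_tree_def by measurable

text \<open>
  The set \<open>B\<close> would decide, for each base point, on a direction in which a simulation exists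
  between its two trees; membership means left to right.
\<close>

lemma no_borel_choice_of_direction:
  assumes B: "B \<in> sets borel"
    and inv: "\<And>x x'. valid x \<Longrightarrow> valid x' \<Longrightarrow> base x = base x' \<Longrightarrow> x \<in> B \<Longrightarrow> x' \<in> B"
    and left: "\<And>x. valid x \<Longrightarrow> x \<in> B \<Longrightarrow> \<exists>x'. valid x' \<and> base x' = base x \<and> left_to_right x'"
    and right: "\<And>x. valid x \<Longrightarrow> x \<notin> B \<Longrightarrow> \<exists>x'. valid x' \<and> base x' = base x \<and> \<not> left_to_right x'"
  shows False
proof -
  have valid: "{x. valid x} \<in> sets borel"
    using pred_valid by (simp add: pred_def)
  define Q where "Q = base ` ({x. valid x} \<inter> B)"
  define Q' where "Q' = base ` ({x. valid x} - B)"
  have Q: "proj_closed Q" and Q': "proj_closed Q'"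
    unfolding Q_def Q'_def base_def
    by (intro proj_closed_col_image borel_imp_proj_closed sets.Int sets.Diff valid B)+
  obtain c where c: "\<And>y. y \<in> Q \<longleftrightarrow> ill_founded (tree c y)"
    using proj_closed_imp_tree[OF Q] by blast
  obtain c' where c': "\<And>y. y \<in> Q' \<longleftrightarrow> ill_founded (tree c' y)"
    using proj_closed_imp_tree[OF Q'] by blast
  have disj: "\<not> (y \<in> Q \<and> y \<in> Q')" for y
  proof
    assume "y \<in> Q \<and> y \<in> Q'"
    then have "y \<in> Q" "y \<in> Q'" by simp_all
    obtain x where "valid x" "x \<in> B" "y = base x"
      using \<open>y \<in> Q\<close> unfolding Q_def by (elim imageE IntE CollectE)
    moreover obtain x' where "valid x'" "x' \<notin> B" "y = base x'"
      using \<open>y \<in> Q'\<close> unfolding Q'_def by (elim imageE DiffE CollectE)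
    ultimately show False
      using inv[of x x'] by simp
  qed
  \<comment> \<open>The base point coding the two decisions: \<open>B\<close> cannot decide correctly about it.\<close>
  define y where "y = join (\<lambda>j. if j = 0 then c else c')"
  have trees: "y \<in> Q \<longleftrightarrow> ill_founded (left_tree y)" "y \<in> Q' \<longleftrightarrow> ill_founded (right_tree y)"
    by (simp_all add: c c' y_def left_tree_def right_tree_def)
  obtain x where x: "valid x" "base x = y"
    using valid_exists by blast
  show False
  proof (cases "x \<in> B")
    case True
    then have "y \<in> Q" using x by (auto simp: Q_def)
    moreover obtain x' where "valid x'" "base x' = y" "left_to_right x'"
      using left[of x] True x by auto
    ultimately show False
      using valid_ill_founded(1)[of x'] trees disj by auto
  next
    case False
    then have "y \<in> Q'" using x by (auto simp: Q'_def)
    moreover obtain x' where "valid x'" "base x' = y" "\<not> left_to_right x'"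
      using right[of x] False x by auto
    ultimately show False
      using valid_ill_founded(2)[of x'] trees disj by auto
  qed
qed

section \<open>Copies of the Baire space\<close>

text \<open>
  The Baire space transported along an injection \<open>h\<close>, which lets it occur in any type that is large
  enough.
\<close>

definition copy :: "(baire \<Rightarrow> 'a) \<Rightarrow> 'a measure" where
  "copy h = vimage_algebra (range h) (inv h) borel"

lemma space_copy [simp]: "space (copy h) = range h"
  by (simp add: copy_def)

lemma measurable_inv_copy [measurable]: "inv h \<in> copy h \<rightarrow>\<^sub>M borel"
  unfolding copy_def by (rule measurable_vimage_algebra1) simp

lemma measurable_copy [measurable]:
  assumes "inj h"
  shows "h \<in> borel \<rightarrow>\<^sub>M copy h"
  unfolding copy_def by (rule measurable_vimage_algebra2) (use assms in simp_all)

lemma completely_metrizable_baire: "completely_metrizable_space (euclidean :: baire topology)"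
proof -
  have "(euclidean :: nat topology) = discrete_topology UNIV"
    by (simp add: topology_eq open_discrete)
  then have "completely_metrizable_space (product_topology (\<lambda>_ :: nat. euclidean :: nat topology) UNIV)"
    by (simp add: completely_metrizable_space_product_topology
        completely_metrizable_space_discrete_topology)
  then show ?thesis
    by (simp add: euclidean_product_topology)
qed

lemma second_countable_euclidean:
  "second_countable (euclidean :: 'a::second_countable_topology topology)"
proof -
  obtain B :: "'a set set" where "countable B" "topological_basis B"
    using ex_countable_basis by blast
  moreover from this have "\<exists>V\<in>B. x \<in> V \<and> V \<subseteq> U" if "open U" "x \<in> U" for U x
    using topological_basisE[of B U x] that by blast
  ultimately show ?thesis
    unfolding second_countable_def by (auto intro!: exI[of _ B] topological_basis_open)
qed

lemma standard_borel_copy: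
  assumes h: "inj h"
  shows "standard_borel (copy h)"
proof -
  define T where "T = pullback_topology (range h) (inv h) (euclidean :: baire topology)"
  have top: "topspace T = range h"
    by (auto simp: T_def topspace_pullback_topology)
  have "continuous_map T euclidean (inv h)"
    using continuous_map_pullback[of euclidean euclidean id "range h" "inv h"]
    by (simp add: T_def)
  moreover have "continuous_map euclidean T h"
    unfolding T_def
    by (rule continuous_map_pullback') (use h in \<open>auto simp: o_def\<close>)
  ultimately have "homeomorphic_maps T euclidean (inv h) h"
    using h by (auto simp: homeomorphic_maps_def top)
  then have "T homeomorphic_space (euclidean :: baire topology)"
    unfolding homeomorphic_space_def by blast
  then have "completely_metrizable_space T" "second_countable T"
    using completely_metrizable_baire second_countable_euclidean
    by (simp_all add: homeomorphic_completely_metrizable_space homeomorphic_space_second_countability)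
  moreover have "sets (copy h) = sigma_sets (topspace T) {U. openin T U}"
  proof -
    have "sets (copy h) = {inv h -` A \<inter> range h |A. A \<in> sigma_sets UNIV {U. open U}}"
      unfolding copy_def by (subst sets_vimage_algebra2) (simp_all add: borel_def)
    also have "\<dots> = sigma_sets (range h) {inv h -` A \<inter> range h |A. A \<in> {U. open U}}"
      by (rule sigma_sets_vimage_commute) simp
    also have "{inv h -` A \<inter> range h |A. A \<in> {U. open U}} = {U. openin T U}"
      by (auto simp: T_def openin_pullback_topology)
    finally show ?thesis by (simp add: top)
  qed
  ultimately show ?thesis
    unfolding standard_borel_def using top by auto
qed

lemma ex_inj_baire:
  assumes "(UNIV :: real set) \<lesssim> (UNIV :: 'a set)"
  shows "\<exists>h :: baire \<Rightarrow> 'a. inj h"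
proof -
  have "inj (\<lambda>f :: baire. range (\<lambda>n. prod_encode (n, f n)))"
  proof (rule injI)
    fix f g :: baire
    assume eq: "range (\<lambda>n. prod_encode (n, f n)) = range (\<lambda>n. prod_encode (n, g n))"
    show "f = g"
    proof
      fix n
      have "prod_encode (n, f n) \<in> range (\<lambda>n. prod_encode (n, g n))"
        unfolding eq[symmetric] by blast
      then show "f n = g n" by auto
    qed
  qed
  then have "(UNIV :: baire set) \<lesssim> (UNIV :: nat set set)"
    unfolding lepoll_def by blast
  also have "\<dots> \<lesssim> (UNIV :: real set)"
    using nat_sets_eqpoll_reals by (rule eqpoll_imp_lepoll)
  also note assms
  finally show ?thesis
    unfolding lepoll_def by blast
qed

text \<open>
  Columns 0 and 1 give a Borel surjection from the Baire space onto the square. Sending the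
  preimage of the complement of \<open>E\<close> to one point of \<open>E\<close> turns it into a surjection onto \<open>E\<close>.
\<close>

lemma analytic_set_prod_copy:
  fixes h :: "baire \<Rightarrow> 'a"
  assumes h: "inj h" and E: "E \<in> sets (copy h \<Otimes>\<^sub>M copy h)"
  shows "analytic_set (copy h \<Otimes>\<^sub>M copy h) E"
proof (cases "E = {}")
  case False
  then obtain e where e: "e \<in> E" by blast
  define p where "p z = (h (col 0 z), h (col 1 z))" for z
  have col: "col j \<in> borel \<rightarrow>\<^sub>M borel" for j
    by (intro borel_measurable_continuous_onI continuous_col_intros)
  have p: "p \<in> borel \<rightarrow>\<^sub>M copy h \<Otimes>\<^sub>M copy h"
    unfolding p_def
    by (intro measurable_Pair measurable_compose[OF col measurable_copy[OF h]])
  have "e \<in> space (copy h \<Otimes>\<^sub>M copy h)"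
    using sets.sets_into_space[OF E] e by blast
  moreover have "{z \<in> space borel. p z \<in> E} \<in> sets borel"
    using measurable_sets[OF p E] by (simp add: vimage_def)
  ultimately have "(\<lambda>z. if p z \<in> E then p z else e) \<in> borel \<rightarrow>\<^sub>M copy h \<Otimes>\<^sub>M copy h"
    by (intro measurable_If p measurable_const)
  moreover have "E = range (\<lambda>z. if p z \<in> E then p z else e)"
  proof (intro equalityI subsetI)
    fix q assume q: "q \<in> E"
    then obtain a b where "q = (h a, h b)"
      using sets.sets_into_space[OF E] by (auto simp: space_pair_measure)
    then have "q = p (join (\<lambda>j. if j = 0 then a else b))"
      by (simp add: p_def)
    with q show "q \<in> range (\<lambda>z. if p z \<in> E then p z else e)"
      by (intro range_eqI[of _ _ "join (\<lambda>j. if j = 0 then a else b)"]) simp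
  qed (use e in \<open>auto split: if_splits\<close>)
  ultimately show ?thesis
    unfolding analytic_set_def by blast
qed (simp add: analytic_set_def)

lemma borel_diagonal: "{p :: baire \<times> baire. fst p = snd p} \<in> sets (borel \<Otimes>\<^sub>M borel)"
proof -
  have "{p :: baire \<times> baire. fst p = snd p} = (\<Inter>n. \<Union>k. {x. x n = k} \<times> {x. x n = k})"
    by (auto simp: fun_eq_iff)
  moreover have "{x :: baire. x n = k} \<in> sets borel" for n k
    using measurable_sets[OF measurable_coordinate, of "{k}" n] by (simp add: vimage_def)
  then have "(\<Inter>n. \<Union>k. {x. x n = k} \<times> {x :: baire. x n = k}) \<in> sets (borel \<Otimes>\<^sub>M borel)"
    by (intro sets.countable_INT sets.countable_UN image_subsetI pair_measureI) auto
  ultimately show ?thesis by simp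
qed

lemma kernel_in_sets:
  fixes f :: "'a \<Rightarrow> baire"
  assumes "f \<in> M \<rightarrow>\<^sub>M borel"
  shows "{(a, b). a \<in> space M \<and> b \<in> space M \<and> f a = f b} \<in> sets (M \<Otimes>\<^sub>M M)"
proof -
  have "(\<lambda>p. (f (fst p), f (snd p))) \<in> M \<Otimes>\<^sub>M M \<rightarrow>\<^sub>M borel \<Otimes>\<^sub>M borel"
    using assms by measurable
  from measurable_sets[OF this borel_diagonal] show ?thesis
    by (rule back_subst[of "\<lambda>S. S \<in> _"]) (auto simp: space_pair_measure)
qed

section \<open>A non-idealistic relation reducible to the identity\<close>

text \<open>
  Points that are not simulation triples are collected in a single class, which keeps the whole Baire
  space as the domain. The successor separates the constant 0, their value, from all base points.
\<close>

definition reduct :: "baire \<Rightarrow> baire" where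
  "reduct x = (\<lambda>n. if valid x then Suc (base x n) else 0)"

lemma reduct_eq_iff:
  assumes "valid x"
  shows "reduct x = reduct x' \<longleftrightarrow> valid x' \<and> base x = base x'"
  using assms by (auto simp: reduct_def fun_eq_iff)

lemma measurable_reduct [measurable]: "reduct \<in> borel \<rightarrow>\<^sub>M borel"
proof (rule measurable_coordinatewise_then_product)
  fix n
  show "(\<lambda>x. reduct x n) \<in> borel \<rightarrow>\<^sub>M borel"
    unfolding reduct_def base_def col_def by measurable
qed

definition reduct_kernel :: "(baire \<Rightarrow> 'a) \<Rightarrow> ('a \<times> 'a) set" where
  "reduct_kernel h =
     {(a, b). a \<in> space (copy h) \<and> b \<in> space (copy h) \<and> reduct (inv h a) = reduct (inv h b)}"

lemma equiv_reduct_kernel: "equiv (space (copy h)) (reduct_kernel h)"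
  by (rule equivI) (auto simp: reduct_kernel_def intro!: refl_onI symI transI)

lemma analytic_reduct_kernel:
  assumes "inj h"
  shows "analytic_equiv_rel (copy h) (reduct_kernel h)"
  unfolding analytic_equiv_rel_def
proof (intro conjI standard_borel_copy equiv_reduct_kernel analytic_set_prod_copy assms)
  show "reduct_kernel h \<in> sets (copy h \<Otimes>\<^sub>M copy h)"
    unfolding reduct_kernel_def by (rule kernel_in_sets) measurable
qed

lemma reduct_kernel_reducible:
  assumes "inj h"
  shows "borel_reducible (copy h) (reduct_kernel h) (copy h) (Id_on (space (copy h)))"
  unfolding borel_reducible_def
proof (intro bexI ballI)
  show "(\<lambda>a. h (reduct (inv h a))) \<in> copy h \<rightarrow>\<^sub>M copy h"
    by (rule measurable_compose[OF _ measurable_copy[OF assms]]) measurable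
qed (auto simp: reduct_kernel_def Id_on_def inj_eq[OF assms])

lemma countable_borel_identity:
  assumes "inj h"
  shows "countable_borel_equiv_rel (copy h) (Id_on (space (copy h)))"
  unfolding countable_borel_equiv_rel_def
proof (intro conjI standard_borel_copy assms ballI)
  show "equiv (space (copy h)) (Id_on (space (copy h)))"
    by (rule equivI) (auto intro!: refl_onI symI transI)
  have "{(a, b). a \<in> space (copy h) \<and> b \<in> space (copy h) \<and> inv h a = inv h b} \<in>
      sets (copy h \<Otimes>\<^sub>M copy h)"
    by (rule kernel_in_sets) measurable
  then show "Id_on (space (copy h)) \<in> sets (copy h \<Otimes>\<^sub>M copy h)"
    by (rule back_subst[of "\<lambda>S. S \<in> _"]) (use assms in \<open>auto simp: Id_on_def\<close>)
next
  fix C assume "C \<in> space (copy h) // Id_on (space (copy h))"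
  then obtain a where "C = {a}"
    by (auto simp: quotient_def Id_on_def)
  then show "countable C" by simp
qed

text \<open>
  Let \<open>B\<close> be the set of triples in whose class the left-to-right triples do not form a small set.
  It is Borel because the assignment of ideals is. A set that is not small is nonempty, as \<open>{}\<close> is
  small; and if the left-to-right triples form a small set, some triple goes the other way, as the
  class is not small. So \<open>B\<close> would choose directions.
\<close>

lemma not_idealistic_reduct_kernel:
  assumes h: "inj h"
  shows "\<not> idealistic (copy h) (reduct_kernel h)"
proof
  let ?M = "copy h" and ?E = "reduct_kernel h"
  assume "idealistic ?M ?E"
  then obtain I where
    I: "\<And>C. C \<in> space ?M // ?E \<Longrightarrow> sigma_ideal_on C (I C) \<and> C \<notin> I C" and
    borel_I: "\<And>A. A \<in> sets (?M \<Otimes>\<^sub>M ?M) \<Longrightarrow>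
      {a \<in> space ?M. {b \<in> ?E `` {a}. (a, b) \<in> A} \<in> I (?E `` {a})} \<in> sets ?M"
    unfolding idealistic_def by blast
  define A where "A = space ?M \<times> {b \<in> space ?M. left_to_right (inv h b)}"
  have "{b \<in> space ?M. left_to_right (inv h b)} \<in> sets ?M"
    by measurable
  then have A: "A \<in> sets (?M \<Otimes>\<^sub>M ?M)"
    unfolding A_def by (intro pair_measureI sets.top)
  define C where "C x = ?E `` {h x}" for x
  define small where "small C \<longleftrightarrow> {b \<in> C. left_to_right (inv h b)} \<in> I C" for C
  have mem_C: "h x' \<in> C x \<longleftrightarrow> valid x' \<and> base x' = base x" if "valid x" for x x'
    using reduct_eq_iff[OF that, of x'] by (auto simp: C_def reduct_kernel_def h)
  have C_range: "\<exists>x'. b = h x'" if "b \<in> C x" for b x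
    using that by (auto simp: C_def reduct_kernel_def)
  have C_quot: "C x \<in> space ?M // ?E" for x
    by (simp add: C_def quotientI)
  have "{b \<in> ?E `` {a}. (a, b) \<in> A} = {b \<in> ?E `` {a}. left_to_right (inv h b)}" for a
    by (auto simp: A_def reduct_kernel_def)
  then have "{a \<in> space ?M. small (?E `` {a})} =
      {a \<in> space ?M. {b \<in> ?E `` {a}. (a, b) \<in> A} \<in> I (?E `` {a})}"
    by (simp only: small_def)
  with borel_I[OF A] have "{a \<in> space ?M. small (?E `` {a})} \<in> sets ?M"
    by simp
  from measurable_sets[OF measurable_copy[OF h] this]
  have "{x. small (C x)} \<in> sets borel"
    by (simp add: vimage_def C_def)
  then have B: "{x. \<not> small (C x)} \<in> sets borel"
    using sets.compl_sets[of "{x. small (C x)}" borel]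
    by (simp add: Compl_eq_Diff_UNIV[symmetric] Collect_neg_eq)
  show False
  proof (rule no_borel_choice_of_direction[OF B])
    fix x x' assume "valid x" "valid x'" "base x = base x'" "x \<in> {x. \<not> small (C x)}"
    moreover from this have "C x = C x'"
      using mem_C C_range by (metis subsetI subset_antisym)
    ultimately show "x' \<in> {x. \<not> small (C x)}" by simp
  next
    fix x assume x: "valid x" "x \<in> {x. \<not> small (C x)}"
    have "{} \<in> I (C x)"
      using I[OF C_quot] by (simp add: sigma_ideal_on_def)
    then obtain b where "b \<in> C x" "left_to_right (inv h b)"
      using x(2) by (auto simp: small_def) (metis (mono_tags, lifting) empty_Collect_eq)
    then show "\<exists>x'. valid x' \<and> base x' = base x \<and> left_to_right x'"
      using C_range mem_C[OF x(1)] h by (metis inv_f_f)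
  next
    fix x assume x: "valid x" "x \<notin> {x. \<not> small (C x)}"
    then have "{b \<in> C x. left_to_right (inv h b)} \<noteq> C x"
      using I[OF C_quot, of x] by (auto simp: small_def)
    then obtain b where "b \<in> C x" "\<not> left_to_right (inv h b)"
      by blast
    then show "\<exists>x'. valid x' \<and> base x' = base x \<and> \<not> left_to_right x'"
      using C_range mem_C[OF x(1)] h by (metis inv_f_f)
  qed
qed

theorem corollary2p12:
  fixes \<E> :: "('a measure \<times> ('a \<times> 'a) set) set"
  assumes universe: "(UNIV :: real set) \<lesssim> (UNIV :: 'a set)"
    and analytic: "\<And>M E. (M, E) \<in> \<E> \<Longrightarrow> analytic_equiv_rel M E"
    and idealistic: "\<And>M E. (M, E) \<in> \<E> \<Longrightarrow> idealistic M E"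
    and countable: "\<And>M E. countable_borel_equiv_rel M E \<Longrightarrow> (M, E) \<in> \<E>"
  shows "\<not> downward_closed \<E>"
proof
  assume closed: "downward_closed \<E>"
  obtain h :: "baire \<Rightarrow> 'a" where h: "inj h"
    using ex_inj_baire[OF universe] by blast
  have "(copy h, Id_on (space (copy h))) \<in> \<E>"
    by (rule countable[OF countable_borel_identity[OF h]])
  then have "(copy h, reduct_kernel h) \<in> \<E>"
    using closed analytic_reduct_kernel[OF h] reduct_kernel_reducible[OF h]
    unfolding downward_closed_def by blast
  with not_idealistic_reduct_kernel[OF h] show False
    using idealistic by blast
qed

end
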